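(* If $n\ge 6$ is an even integer, then $$\chi(Q_{n}^{[\natural n-4]}) \le \min\{2\chi(J(n,(n-4)/2,0))+\chi(J(n,n/2,2)),\ 2\chi(J(n,(n-2)/2,1))+2 \} \le 2\chi(K(8,3,1))+2.$$
   Context: $Q_n^{[\natural p]}$ is the graph on $\{0,1\}^n$ in which two vertices are adjacent iff they differ in exactly $p$ coordinates. For integers $i\le k\le n$, the generalized Johnson graph $J(n,k,i)$ has vertex set $\{A\subseteq\{1,\ldots,n\}: |A|=k\}$ and edge set $\{AB: |A\cap B|=i\}$; the generalized Kneser graph $K(n,k,i)$ has the same vertex set, two distinct vertices $A,B$ being adjacent iff $|A\cap B|\le i$. $\chi$ denotes the chromatic number. *)

theory Defs
  imports "Graph_Theory.Pair_Digraph" "HOL-Library.FuncSet"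
begin

text \<open>
  Simple graphs are values of type \<^typ>\<open>'a pair_pre_digraph\<close> satisfying
  \<^const>\<open>pair_graph\<close>: an undirected edge is represented by the two opposite arcs.
\<close>

definition proper_colouring :: "'a pair_pre_digraph \<Rightarrow> nat \<Rightarrow> ('a \<Rightarrow> nat) \<Rightarrow> bool" where
  "proper_colouring G k c \<longleftrightarrow>
     c ` pverts G \<subseteq> {..<k} \<and> (\<forall>(u, v) \<in> parcs G. c u \<noteq> c v)"

definition chromatic_number :: "'a pair_pre_digraph \<Rightarrow> nat" where
  "chromatic_number G = (LEAST k. \<exists>c. proper_colouring G k c)"

text \<open>
  In the next two definitions distinctness of the endpoints only matters in the degenerate cases
  \<open>p = 0\<close> and \<open>i = k\<close>, where it excludes loops.
\<close>

definition exact_distance_cube :: "nat \<Rightarrow> nat \<Rightarrow> (nat \<Rightarrow> nat) pair_pre_digraph" where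
  "exact_distance_cube n p =
    (let V = {1..n} \<rightarrow>\<^sub>E {0, 1} in
      \<lparr> pverts = V,
        parcs = {(x, y). x \<in> V \<and> y \<in> V \<and> x \<noteq> y \<and> card {j \<in> {1..n}. x j \<noteq> y j} = p} \<rparr>)"

definition johnson_graph :: "nat \<Rightarrow> nat \<Rightarrow> nat \<Rightarrow> nat set pair_pre_digraph" where
  "johnson_graph n k i =
    (let V = {A. A \<subseteq> {1..n} \<and> card A = k} in
      \<lparr> pverts = V,
        parcs = {(A, B). A \<in> V \<and> B \<in> V \<and> A \<noteq> B \<and> card (A \<inter> B) = i} \<rparr>)"

definition kneser_graph :: "nat \<Rightarrow> nat \<Rightarrow> nat \<Rightarrow> nat set pair_pre_digraph" where
  "kneser_graph n k i =
    (let V = {A. A \<subseteq> {1..n} \<and> card A = k} in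
      \<lparr> pverts = V,
        parcs = {(A, B). A \<in> V \<and> B \<in> V \<and> A \<noteq> B \<and> card (A \<inter> B) \<le> i} \<rparr>)"

lemma pair_graphI:
  assumes "finite V" and "\<And>x y. R x y \<Longrightarrow> R y x"
  shows "pair_graph \<lparr> pverts = V, parcs = {(x, y). x \<in> V \<and> y \<in> V \<and> x \<noteq> y \<and> R x y} \<rparr>"
proof -
  have "finite {(x, y). x \<in> V \<and> y \<in> V \<and> x \<noteq> y \<and> R x y}"
    by (rule finite_subset[of _ "V \<times> V"]) (use assms in auto)
  then show ?thesis
    using assms by unfold_locales (auto simp: symmetric_def intro!: symI)
qed

lemma pair_graph_exact_distance_cube: "pair_graph (exact_distance_cube n p)"
  unfolding exact_distance_cube_def Let_def
proof (rule pair_graphI)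
  show "finite ({1..n} \<rightarrow>\<^sub>E {0, 1::nat})"
    by (simp add: finite_PiE)
  fix x y :: "nat \<Rightarrow> nat"
  assume "card {j \<in> {1..n}. x j \<noteq> y j} = p"
  moreover have "{j \<in> {1..n}. y j \<noteq> x j} = {j \<in> {1..n}. x j \<noteq> y j}"
    by force
  ultimately show "card {j \<in> {1..n}. y j \<noteq> x j} = p"
    by metis
qed

lemma pair_graph_johnson_graph: "pair_graph (johnson_graph n k i)"
  unfolding johnson_graph_def Let_def
  by (rule pair_graphI) (simp_all add: Int_commute)

lemma pair_graph_kneser_graph: "pair_graph (kneser_graph n k i)"
  unfolding kneser_graph_def Let_def
  by (rule pair_graphI) (simp_all add: Int_commute)

lemma proper_colouring_chromatic_number:
  assumes "pair_graph G"
  shows "\<exists>c. proper_colouring G (chromatic_number G) c"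
proof -
  interpret pair_graph G by fact
  obtain c where c: "bij_betw c (pverts G) {0..<card (pverts G)}"
    using ex_bij_betw_finite_nat[OF pair_finite_verts] by blast
  have "proper_colouring G (card (pverts G)) c"
    unfolding proper_colouring_def
  proof (intro conjI ballI)
    show "c ` pverts G \<subseteq> {..<card (pverts G)}"
      using c by (auto simp: bij_betw_def)
    fix e assume "e \<in> parcs G"
    then have "fst e \<in> pverts G" "snd e \<in> pverts G" "fst e \<noteq> snd e"
      using arc_fst_in_verts arc_snd_in_verts pair_no_loops by auto
    then show "case e of (u, v) \<Rightarrow> c u \<noteq> c v"
      using c by (auto simp: bij_betw_def inj_on_def split: prod.split)
  qed
  then show ?thesis
    unfolding chromatic_number_def by (rule LeastI[where P = "\<lambda>k. \<exists>c. proper_colouring G k c", OF exI])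
qed

end

theory Submission
  imports Defs
begin

text \<open>
  Identify vertices of the cube with subsets of \<open>{1..n}\<close>. Adjacent vertices have the same parity and
  flipping one coordinate exchanges the parity classes, so it suffices to colour one of the classes.
  Complementation preserves distances, so the levels above \<open>n / 2\<close> are coloured like those below.
  In the class of \<open>n / 2\<close>, all edges below the middle level lie inside level \<open>(n - 4) / 2\<close>; in the
  other class, all edges below the middle meet level \<open>(n - 2) / 2\<close>, so one extra colour serves the
  lower levels. The two classes give the two terms of the minimum.

  For the second inequality, \<open>J(n, (n-2)/2, 1)\<close> is a subgraph of \<open>K(n, (n-2)/2, 1)\<close>, and Stahl's
  homomorphism \<open>K(n+2, k+1, 0) \<rightarrow> K(n, k, 0)\<close> is also a homomorphism
  \<open>K(n+2, k+1, 1) \<rightarrow> K(n, k, 1)\<close>, which leads down to \<open>K(8, 3, 1)\<close>. For \<open>n = 6\<close> a one-factorization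
  of \<open>K\<^sub>6\<close> is combined with a 5-clique of \<open>K(8, 3, 1)\<close>.
\<close>

section \<open>Colourings and homomorphisms\<close>

lemma chromatic_number_le: "proper_colouring G k c \<Longrightarrow> chromatic_number G \<le> k"
  unfolding chromatic_number_def by (rule Least_le) blast

lemma chromatic_number_hom_le:
  assumes "pair_graph H"
    and "\<And>u. u \<in> pverts G \<Longrightarrow> f u \<in> pverts H"
    and "\<And>u v. (u, v) \<in> parcs G \<Longrightarrow> (f u, f v) \<in> parcs H"
  shows "chromatic_number G \<le> chromatic_number H"
proof -
  obtain c where "proper_colouring H (chromatic_number H) c"
    using proper_colouring_chromatic_number[OF assms(1)] by blast
  then have "proper_colouring G (chromatic_number H) (c \<circ> f)"
    using assms(2,3) unfolding proper_colouring_def by fastforce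
  then show ?thesis
    by (rule chromatic_number_le)
qed

lemma johnson_colouring_exists:
  obtains c where
    "\<And>A. A \<subseteq> {1..n} \<Longrightarrow> card A = k \<Longrightarrow> c A < chromatic_number (johnson_graph n k i)"
    "\<And>A B. A \<subseteq> {1..n} \<Longrightarrow> card A = k \<Longrightarrow> B \<subseteq> {1..n} \<Longrightarrow> card B = k \<Longrightarrow> A \<noteq> B
       \<Longrightarrow> card (A \<inter> B) = i \<Longrightarrow> c A \<noteq> c B"
proof -
  obtain c where "proper_colouring (johnson_graph n k i) (chromatic_number (johnson_graph n k i)) c"
    using proper_colouring_chromatic_number[OF pair_graph_johnson_graph] by blast
  then show thesis
    by (intro that[of c]) (auto simp: proper_colouring_def johnson_graph_def Let_def)
qed

section \<open>Colouring the cube level by level\<close>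

lemma card_sym_diff:
  assumes "finite A" "finite B"
  shows "card (sym_diff A B) + 2 * card (A \<inter> B) = card A + card B"
proof -
  have "card (sym_diff A B) = card (A - B) + card (B - A)"
    using assms by (intro card_Un_disjoint) auto
  moreover have "card A = card (A - B) + card (A \<inter> B)"
    using card_Diff_subset_Int[of A B] card_mono[of A "A \<inter> B"] assms by auto
  moreover have "card B = card (B - A) + card (A \<inter> B)"
    using card_Diff_subset_Int[of B A] card_mono[of B "A \<inter> B"] assms by (auto simp: Int_commute)
  ultimately show ?thesis by linarith
qed

text \<open>An even distance keeps both ends of an edge in one parity class, and toggling the
  element 1 moves the other class onto the chosen one. The Boolean \<open>e\<close> selects the
  class, so each bound below can colour the parity that suits it.\<close>

lemma chromatic_number_cube_le:
  fixes c :: "nat set \<Rightarrow> nat"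
  assumes "even p" and "1 \<le> n"
    and range: "\<And>A. A \<subseteq> {1..n} \<Longrightarrow> even (card A) = e \<Longrightarrow> c A < k"
    and proper: "\<And>A B. A \<subseteq> {1..n} \<Longrightarrow> B \<subseteq> {1..n} \<Longrightarrow> even (card A) = e \<Longrightarrow> even (card B) = e
        \<Longrightarrow> A \<noteq> B \<Longrightarrow> card (sym_diff A B) = p \<Longrightarrow> c A \<noteq> c B"
  shows "chromatic_number (exact_distance_cube n p) \<le> k"
proof -
  define S :: "(nat \<Rightarrow> nat) \<Rightarrow> nat set" where "S x = {j \<in> {1..n}. x j = 1}" for x
  define g where "g A = (if even (card A) = e then A else sym_diff A {1})" for A :: "nat set"
  have S_sub: "S x \<subseteq> {1..n}" and S_fin: "finite (S x)" for x
    unfolding S_def by auto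
  have g_sub: "g A \<subseteq> {1..n}" if "A \<subseteq> {1..n}" for A
    using that \<open>1 \<le> n\<close> unfolding g_def by auto
  have g_par: "even (card (g A)) = e" if "A \<subseteq> {1..n}" for A
  proof -
    have "finite A"
      using that finite_subset by blast
    then have "card (sym_diff A {1}) + 2 * card (A \<inter> {1}) = card A + 1"
      using card_sym_diff[of A "{1}"] by simp
    then have "even (card (sym_diff A {1})) \<noteq> even (card A)"
      by presburger
    then show ?thesis
      unfolding g_def by auto
  qed
  have "proper_colouring (exact_distance_cube n p) k (c \<circ> g \<circ> S)"
    unfolding proper_colouring_def
  proof (intro conjI ballI)
    show "(c \<circ> g \<circ> S) ` pverts (exact_distance_cube n p) \<subseteq> {..<k}"
      using range g_sub g_par S_sub by auto
    fix a assume "a \<in> parcs (exact_distance_cube n p)"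
    then obtain x y where a: "a = (x, y)"
      and V: "x \<in> {1..n} \<rightarrow>\<^sub>E {0, 1}" "y \<in> {1..n} \<rightarrow>\<^sub>E {0, 1}"
      and ne: "x \<noteq> y" and dist: "card {j \<in> {1..n}. x j \<noteq> y j} = p"
      by (auto simp: exact_distance_cube_def Let_def)
    have val: "x j = 0 \<or> x j = 1" "y j = 0 \<or> y j = 1" if "j \<in> {1..n}" for j
      using V that by (auto dest!: PiE_mem)
    have "{j \<in> {1..n}. x j \<noteq> y j} = sym_diff (S x) (S y)"
      using val unfolding S_def by fastforce
    then have sd: "card (sym_diff (S x) (S y)) = p"
      using dist by simp
    have S_ne: "S x \<noteq> S y"
    proof
      assume eq: "S x = S y"
      have "x j = y j" if "j \<in> {1..n}" for j
      proof -
        have "x j = 1 \<longleftrightarrow> y j = 1"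
          using eq that unfolding S_def by blast
        then show ?thesis
          using val[OF that] by metis
      qed
      then show False
        using ne PiE_ext[OF V] by blast
    qed
    have "even (card (S x)) = even (card (S y))"
      using card_sym_diff[OF S_fin S_fin, of x y] sd \<open>even p\<close> by (metis dvd_triv_left even_add)
    \<comment> \<open>Equal parity means that \<open>g\<close> toggles 1 in both sets or in neither,
      so the toggles cancel in the symmetric difference.\<close>
    then have "sym_diff (g (S x)) (g (S y)) = sym_diff (S x) (S y)"
      unfolding g_def by auto
    then have "card (sym_diff (g (S x)) (g (S y))) = p" "g (S x) \<noteq> g (S y)"
      using sd S_ne by auto
    then show "case a of (u, v) \<Rightarrow> (c \<circ> g \<circ> S) u \<noteq> (c \<circ> g \<circ> S) v"
      using proper[OF g_sub[OF S_sub] g_sub[OF S_sub] g_par[OF S_sub] g_par[OF S_sub]]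
      by (simp add: a)
  qed
  then show ?thesis
    by (rule chromatic_number_le)
qed

section \<open>Two explicit colourings of the cube\<close>

lemma sym_diff_complement:
  assumes "A \<subseteq> V" "B \<subseteq> V"
  shows "sym_diff (V - A) (V - B) = sym_diff A B"
  using assms by auto

lemma card_complement:
  assumes "A \<subseteq> {1..n}"
  shows "card ({1..n} - A) + card A = n"
  using assms card_mono[of "{1..n}" A] by (simp add: card_Diff_subset finite_subset)

lemma cube_chromatic_le_middle_level:
  assumes "3 \<le> m"
  shows "chromatic_number (exact_distance_cube (2 * m) (2 * m - 4))
    \<le> 2 * chromatic_number (johnson_graph (2 * m) (m - 2) 0)
        + chromatic_number (johnson_graph (2 * m) m 2)"
proof -
  let ?V = "{1..2 * m}"
  define k where "k = chromatic_number (johnson_graph (2 * m) (m - 2) 0)"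
  define l where "l = chromatic_number (johnson_graph (2 * m) m 2)"
  obtain f where f: "\<And>A. A \<subseteq> ?V \<Longrightarrow> card A = m - 2 \<Longrightarrow> f A < k"
    "\<And>A B. A \<subseteq> ?V \<Longrightarrow> card A = m - 2 \<Longrightarrow> B \<subseteq> ?V \<Longrightarrow> card B = m - 2 \<Longrightarrow> A \<noteq> B
       \<Longrightarrow> card (A \<inter> B) = 0 \<Longrightarrow> f A \<noteq> f B"
    unfolding k_def by (rule johnson_colouring_exists) blast
  obtain h where h: "\<And>A. A \<subseteq> ?V \<Longrightarrow> card A = m \<Longrightarrow> h A < l"
    "\<And>A B. A \<subseteq> ?V \<Longrightarrow> card A = m \<Longrightarrow> B \<subseteq> ?V \<Longrightarrow> card B = m \<Longrightarrow> A \<noteq> B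
       \<Longrightarrow> card (A \<inter> B) = 2 \<Longrightarrow> h A \<noteq> h B"
    unfolding l_def by (rule johnson_colouring_exists) blast
  \<comment> \<open>Sets smaller than m - 2 receive colour 0 of the same palette, so this palette
    must be nonempty.\<close>
  have "0 < k"
    using f(1)[of "{1..m - 2}"] by fastforce
  define low where "low A = (if card A = m - 2 then f A else 0)" for A
  have low_less: "low A < k" if "A \<subseteq> ?V" for A
    using f(1)[OF that] \<open>0 < k\<close> unfolding low_def by auto
  have low_ne: "low A \<noteq> low B"
    if "A \<subseteq> ?V" "B \<subseteq> ?V" "even (card A) = even m" "even (card B) = even m"
      "card A < m" "card B < m" "A \<noteq> B" "card (sym_diff A B) = 2 * m - 4" for A B
  proof -
    have *: "card (sym_diff A B) + 2 * card (A \<inter> B) = card A + card B"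
      using that by (intro card_sym_diff) (auto intro: finite_subset)
    \<comment> \<open>Parity excludes size m - 1, so the sizes sum to at most 2m - 4. Distance 2m -
      4 then forces two disjoint sets of size m - 2.\<close>
    have "card A \<noteq> m - 1" "card B \<noteq> m - 1"
      using that(3,4) assms by auto
    then have "card A \<le> m - 2" "card B \<le> m - 2"
      using that(5,6) by linarith+
    then have "card A = m - 2" "card B = m - 2" "card (A \<inter> B) = 0"
      using * that(8) assms by linarith+
    then show ?thesis
      using f(2)[of A B] that unfolding low_def by simp
  qed
  \<comment> \<open>The palettes are disjoint: [0, k) below the middle, [k, 2k) above it by
    complementation, and [2k, 2k + l) on it. Edges between these three zones are thus
    harmless.\<close>
  define c where "c A = (if card A = m then 2 * k + h A else if card A < m then low A
    else k + low (?V - A))" for A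
  have "chromatic_number (exact_distance_cube (2 * m) (2 * m - 4)) \<le> 2 * k + l"
  proof (rule chromatic_number_cube_le[where c = c and e = "even m"])
    show "even (2 * m - 4)" "1 \<le> 2 * m"
      using assms by auto
    fix A assume A: "A \<subseteq> ?V"
    have "low (?V - A) < k"
      by (rule low_less) auto
    then show "c A < 2 * k + l"
      using h(1)[OF A] low_less[OF A] unfolding c_def by auto
  next
    fix A B
    assume A: "A \<subseteq> ?V" and B: "B \<subseteq> ?V" and ev: "even (card A) = even m" "even (card B) = even m"
      and ne: "A \<noteq> B" and sd: "card (sym_diff A B) = 2 * m - 4"
    have cA: "card (?V - A) + card A = 2 * m" and cB: "card (?V - B) + card B = 2 * m"
      using card_complement A B by blast+
    have less: "low A < k" "low B < k" "low (?V - A) < k" "low (?V - B) < k"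
      using low_less A B Diff_subset by metis+
    consider "card A = m" "card B = m" | "card A < m" "card B < m" | "m < card A" "m < card B"
      | "card A = m \<longleftrightarrow> card B \<noteq> m" | "card A < m" "m < card B" | "m < card A" "card B < m"
      by linarith
    then show "c A \<noteq> c B"
    proof cases
      case 1
      have "card (sym_diff A B) + 2 * card (A \<inter> B) = card A + card B"
        using A B by (intro card_sym_diff) (auto intro: finite_subset)
      then have "card (A \<inter> B) = 2"
        using 1 sd assms by linarith
      then show ?thesis
        using 1 h(2)[OF A _ B] ne unfolding c_def by auto
    next
      case 2
      then show ?thesis
        using low_ne[OF A B ev _ _ ne sd] unfolding c_def by auto
    next
      case 3
      have "low (?V - A) \<noteq> low (?V - B)"
      proof (rule low_ne)
        show "even (card (?V - A)) = even m" "even (card (?V - B)) = even m"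
          using ev cA cB by presburger+
        show "card (?V - A) < m" "card (?V - B) < m"
          using 3 cA cB by linarith+
        show "?V - A \<noteq> ?V - B"
          using ne A B by blast
        show "card (sym_diff (?V - A) (?V - B)) = 2 * m - 4"
          using sd by (simp only: sym_diff_complement[OF A B])
      qed auto
      then show ?thesis
        using 3 unfolding c_def by auto
    qed (use less in \<open>auto simp: c_def\<close>)
  qed
  then show ?thesis
    unfolding k_def l_def .
qed

lemma cube_chromatic_le_near_middle_level:
  assumes "3 \<le> m"
  shows "chromatic_number (exact_distance_cube (2 * m) (2 * m - 4))
    \<le> 2 * chromatic_number (johnson_graph (2 * m) (m - 1) 1) + 2"
proof -
  let ?V = "{1..2 * m}"
  define k where "k = chromatic_number (johnson_graph (2 * m) (m - 1) 1)"
  obtain f where f: "\<And>A. A \<subseteq> ?V \<Longrightarrow> card A = m - 1 \<Longrightarrow> f A < k"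
    "\<And>A B. A \<subseteq> ?V \<Longrightarrow> card A = m - 1 \<Longrightarrow> B \<subseteq> ?V \<Longrightarrow> card B = m - 1 \<Longrightarrow> A \<noteq> B
       \<Longrightarrow> card (A \<inter> B) = 1 \<Longrightarrow> f A \<noteq> f B"
    unfolding k_def by (rule johnson_colouring_exists) blast
  \<comment> \<open>Colour \<open>k\<close> is not a value of \<open>f\<close> on level m - 1, so it
    can serve all lower levels together.\<close>
  define low where "low A = (if card A = m - 1 then f A else k)" for A
  have low_less: "low A < k + 1" if "A \<subseteq> ?V" for A
    using f(1)[OF that] unfolding low_def by auto
  have low_ne: "low A \<noteq> low B"
    if "A \<subseteq> ?V" "B \<subseteq> ?V" "even (card A) \<noteq> even m" "even (card B) \<noteq> even m"
      "card A < m" "card B < m" "A \<noteq> B" and sd: "card (sym_diff A B) = 2 * m - 4" for A B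
  proof -
    have *: "card (sym_diff A B) + 2 * card (A \<inter> B) = card A + card B"
      using that by (intro card_sym_diff) (auto intro: finite_subset)
    have "card A \<noteq> m - 2" "card B \<noteq> m - 2"
      using that(3,4) assms by auto
    then have "card A = m - 1 \<or> card A \<le> m - 3" "card B = m - 1 \<or> card B \<le> m - 3"
      using that(5,6) by linarith+
    \<comment> \<open>Two sets of size at most m - 3 have total size at most 2m - 6, too small for
      distance 2m - 4.\<close>
    then have "card A = m - 1 \<or> card B = m - 1"
      using * sd assms by linarith
    then consider (both) "card A = m - 1" "card B = m - 1"
      | (left) "card A = m - 1" "card B \<noteq> m - 1" | (right) "card A \<noteq> m - 1" "card B = m - 1"
      by blast
    then show ?thesis
    proof cases
      case both
      then have "card (A \<inter> B) = 1"
        using * sd assms by linarith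
      then show ?thesis
        using both f(2)[of A B] that sd unfolding low_def by simp
    qed (use f(1)[of A] f(1)[of B] that in \<open>auto simp: low_def\<close>)
  qed
  \<comment> \<open>The middle level has the wrong parity, so two palettes of k + 1 colours
    suffice.\<close>
  define c where "c A = (if card A < m then low A else k + 1 + low (?V - A))" for A
  have "chromatic_number (exact_distance_cube (2 * m) (2 * m - 4)) \<le> 2 * k + 2"
  proof (rule chromatic_number_cube_le[where c = c and e = "odd m"])
    show "even (2 * m - 4)" "1 \<le> 2 * m"
      using assms by auto
    fix A assume A: "A \<subseteq> ?V"
    have "low (?V - A) < k + 1"
      by (rule low_less) auto
    then show "c A < 2 * k + 2"
      using low_less[OF A] unfolding c_def by auto
  next
    fix A B
    assume A: "A \<subseteq> ?V" and B: "B \<subseteq> ?V" and ev: "even (card A) = odd m" "even (card B) = odd m"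
      and ne: "A \<noteq> B" and sd: "card (sym_diff A B) = 2 * m - 4"
    have cA: "card (?V - A) + card A = 2 * m" and cB: "card (?V - B) + card B = 2 * m"
      using card_complement A B by blast+
    have less: "low A < k + 1" "low B < k + 1"
      using low_less A B by blast+
    have "card A \<noteq> m" "card B \<noteq> m"
      using ev by auto
    then consider "card A < m" "card B < m" | "m < card A" "m < card B"
      | "card A < m" "m < card B" | "m < card A" "card B < m"
      by linarith
    then show "c A \<noteq> c B"
    proof cases
      case 1
      then show ?thesis
        using low_ne[OF A B _ _ _ _ ne sd] ev unfolding c_def by auto
    next
      case 2
      have "low (?V - A) \<noteq> low (?V - B)"
      proof (rule low_ne)
        show "even (card (?V - A)) \<noteq> even m" "even (card (?V - B)) \<noteq> even m"
          using ev cA cB by presburger+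
        show "card (?V - A) < m" "card (?V - B) < m"
          using 2 cA cB by linarith+
        show "?V - A \<noteq> ?V - B"
          using ne A B by blast
        show "card (sym_diff (?V - A) (?V - B)) = 2 * m - 4"
          using sd by (simp only: sym_diff_complement[OF A B])
      qed auto
      then show ?thesis
        using 2 unfolding c_def by auto
    qed (use less in \<open>auto simp: c_def\<close>)
  qed
  then show ?thesis
    unfolding k_def .
qed

section \<open>Reduction to \<open>K(8, 3, 1)\<close>\<close>

text \<open>Deleting the maximum lands in \<open>{1..n}\<close> unless both top points belong to
  \<open>A\<close>. In that case both must go and one point is refilled to restore the size. Taking
  the largest gap ensures that every point above it lies in \<open>A\<close>, which controls the new
  intersections.\<close>

definition stahl_map :: "nat \<Rightarrow> nat set \<Rightarrow> nat set" where
  "stahl_map n A =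
    (if {n + 1, n + 2} \<subseteq> A then insert (Max ({1..n} - A)) (A \<inter> {1..n}) else A - {Max A})"

lemma stahl_map_vertex:
  assumes A: "A \<subseteq> {1..n + 2}" "card A = k + 1" and "k \<le> n"
  shows "stahl_map n A \<subseteq> {1..n}" and "card (stahl_map n A) = k"
    and "{n + 1, n + 2} \<subseteq> A \<Longrightarrow> Max ({1..n} - A) \<in> {1..n} - A"
proof -
  have fin: "finite A" using A finite_subset by blast
  have "stahl_map n A \<subseteq> {1..n} \<and> card (stahl_map n A) = k
    \<and> ({n + 1, n + 2} \<subseteq> A \<longrightarrow> Max ({1..n} - A) \<in> {1..n} - A)"
  proof (cases "{n + 1, n + 2} \<subseteq> A")
    case True
    have "A \<inter> {1..n} = A - {n + 1, n + 2}"
      using A(1) by (auto simp: subset_iff)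
    then have card: "card (A \<inter> {1..n}) + 1 = k"
      using True fin A(2) card_mono[OF fin True] by (simp add: card_Diff_subset)
    \<comment> \<open>Only k - 1 < n points of \<open>{1..n}\<close> are in \<open>A\<close>, so a
      gap exists.\<close>
    have "{1..n} - A \<noteq> {}"
    proof
      assume "{1..n} - A = {}"
      then have "A \<inter> {1..n} = {1..n}" by auto
      then show False using card \<open>k \<le> n\<close> by simp
    qed
    then have M: "Max ({1..n} - A) \<in> {1..n} - A"
      by (intro Max_in) auto
    then show ?thesis
      using True card fin unfolding stahl_map_def by (auto simp: card_insert_if)
  next
    case False
    have "A \<noteq> {}" using A(2) by auto
    then have M: "Max A \<in> A" using fin by (rule Max_in[rotated])
    have sub: "x \<in> {1..n}" if "x \<in> A" "x \<noteq> Max A" for x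
    proof -
      have "x < Max A" using that fin by (simp add: le_neq_trans)
      moreover have "1 \<le> x" "Max A \<le> n + 2" using A(1) M that by auto
      moreover have "\<not> (x = n + 1 \<and> Max A = n + 2)" using False M that by auto
      ultimately show ?thesis by auto
    qed
    have "A - {Max A} \<subseteq> {1..n}"
      using sub by blast
    then show ?thesis
      using False M A(2) by (simp only: stahl_map_def if_False) simp
  qed
  then show "stahl_map n A \<subseteq> {1..n}" "card (stahl_map n A) = k"
    "{n + 1, n + 2} \<subseteq> A \<Longrightarrow> Max ({1..n} - A) \<in> {1..n} - A" by auto
qed

text \<open>The condition on \<open>B\<close> loses nothing for adjacent sets: two sets that both
  contain n + 1 and n + 2 would share two points. Hence at most one image gains a point, and only
  that point can enlarge the intersection.\<close>

lemma stahl_map_Int_le_1: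
  assumes A: "A \<subseteq> {1..n + 2}" "card A = k + 1" and B: "B \<subseteq> {1..n + 2}" "card B = k + 1"
    and "k \<le> n" and le: "card (A \<inter> B) \<le> 1" and nB: "\<not> {n + 1, n + 2} \<subseteq> B"
  shows "card (stahl_map n A \<inter> stahl_map n B) \<le> 1"
proof -
  have fin: "finite A" "finite B" using A B finite_subset by blast+
  have fB: "stahl_map n B = B - {Max B}"
    using nB unfolding stahl_map_def by auto
  show ?thesis
  proof (cases "{n + 1, n + 2} \<subseteq> A")
    case False
    then have "stahl_map n A \<inter> stahl_map n B \<subseteq> A \<inter> B"
      unfolding fB unfolding stahl_map_def by auto
    then show ?thesis
      using le card_mono[of "A \<inter> B"] fin by (meson finite_Int le_trans)
  next
    case True
    define x where "x = Max ({1..n} - A)"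
    have x: "x \<in> {1..n} - A"
      using stahl_map_vertex(3)[OF A \<open>k \<le> n\<close> True] unfolding x_def .
    \<comment> \<open>Up to n this is maximality of the gap \<open>x\<close>; the points n + 1 and n
      + 2 lie in \<open>A\<close> by the case assumption.\<close>
    have above: "y \<in> A" if "x < y" "y \<le> n + 2" for y
    proof (rule ccontr)
      assume "y \<notin> A"
      then have "y \<in> {1..n} - A"
        using that True by (cases "y \<le> n") (auto simp: le_Suc_eq)
      then have "y \<le> x"
        unfolding x_def by (intro Max_ge) auto
      then show False
        using that by simp
    qed
    have fA: "stahl_map n A = insert x (A \<inter> {1..n})"
      using True unfolding stahl_map_def x_def by simp
    show ?thesis
    proof (cases "x \<in> B - {Max B}")
      case False
      then have "stahl_map n A \<inter> stahl_map n B \<subseteq> A \<inter> B"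
        unfolding fA fB by auto
      then show ?thesis
        using le card_mono[of "A \<inter> B"] fin by (meson finite_Int le_trans)
    next
      case x_B: True
      \<comment> \<open>The new common element \<open>x\<close> is paid for by \<open>Max B\<close>, which lies in \<open>A\<close> and is removed.\<close>
      then have M: "Max B \<in> B" using fin by (intro Max_in) auto
      have "x < Max B" using x_B fin by (simp add: le_neq_trans)
      then have "Max B \<in> A \<inter> B" using above M B(1) by auto
      moreover have "\<forall>y \<in> A \<inter> B. \<forall>z \<in> A \<inter> B. y = z"
        using le fin card_le_Suc0_iff_eq[of "A \<inter> B"] by simp
      ultimately have "A \<inter> B = {Max B}"
        by blast
      then have "stahl_map n A \<inter> stahl_map n B \<subseteq> {x}"
        unfolding fA fB by auto
      from card_mono[OF _ this] show ?thesis
        by simp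
    qed
  qed
qed

lemma kneser_chromatic_step:
  assumes "2 \<le> k" "k \<le> n"
  shows "chromatic_number (kneser_graph (n + 2) (k + 1) 1) \<le> chromatic_number (kneser_graph n k 1)"
proof (rule chromatic_number_hom_le[where f = "stahl_map n", OF pair_graph_kneser_graph])
  fix A assume "A \<in> pverts (kneser_graph (n + 2) (k + 1) 1)"
  then show "stahl_map n A \<in> pverts (kneser_graph n k 1)"
    using stahl_map_vertex(1,2)[of A n k] assms by (auto simp: kneser_graph_def Let_def)
next
  fix A B assume "(A, B) \<in> parcs (kneser_graph (n + 2) (k + 1) 1)"
  then have A: "A \<subseteq> {1..n + 2}" "card A = k + 1" and B: "B \<subseteq> {1..n + 2}" "card B = k + 1"
    and le: "card (A \<inter> B) \<le> 1"
    by (auto simp: kneser_graph_def Let_def)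
  have "finite A" using A finite_subset by blast
  then have "\<not> {n + 1, n + 2} \<subseteq> A \<inter> B"
    using le card_mono[of "A \<inter> B" "{n + 1, n + 2}"] by auto
  then consider "\<not> {n + 1, n + 2} \<subseteq> A" | "\<not> {n + 1, n + 2} \<subseteq> B" by blast
  then have le': "card (stahl_map n A \<inter> stahl_map n B) \<le> 1"
  proof cases
    case 1
    then show ?thesis
      using stahl_map_Int_le_1[OF B A \<open>k \<le> n\<close>] le by (simp add: Int_commute)
  next
    case 2
    then show ?thesis
      using stahl_map_Int_le_1[OF A B \<open>k \<le> n\<close>] le by simp
  qed
  \<comment> \<open>Equal images would meet in k \<ge> 2 points.\<close>
  moreover have "stahl_map n A \<noteq> stahl_map n B"
    using le' stahl_map_vertex(2)[OF A \<open>k \<le> n\<close>] \<open>2 \<le> k\<close> by auto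
  ultimately show "(stahl_map n A, stahl_map n B) \<in> parcs (kneser_graph n k 1)"
    using stahl_map_vertex(1,2)[OF A \<open>k \<le> n\<close>] stahl_map_vertex(1,2)[OF B \<open>k \<le> n\<close>]
    by (simp add: kneser_graph_def Let_def)
qed

section \<open>Comparing the Johnson graphs with \<open>K(8, 3, 1)\<close>\<close>

lemma kneser_chromatic_le_8_3:
  assumes "4 \<le> m"
  shows "chromatic_number (kneser_graph (2 * m) (m - 1) 1) \<le> chromatic_number (kneser_graph 8 3 1)"
  using assms
proof (induction m rule: dec_induct)
  case base
  show ?case by simp
next
  case (step m)
  have "chromatic_number (kneser_graph (2 * m + 2) (m - 1 + 1) 1)
      \<le> chromatic_number (kneser_graph (2 * m) (m - 1) 1)"
    using step.hyps by (intro kneser_chromatic_step) auto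
  then show ?case
    using step.IH step.hyps by simp
qed

lemma johnson_chromatic_le_kneser:
  "chromatic_number (johnson_graph n k i) \<le> chromatic_number (kneser_graph n k i)"
  by (rule chromatic_number_hom_le[where f = id, OF pair_graph_kneser_graph])
    (auto simp: johnson_graph_def kneser_graph_def Let_def)

text \<open>
  The classical one-factorization of \<open>K\<^sub>6\<close>, with \<open>6\<close> as the point at infinity over the integers
  modulo 5.
\<close>

definition k6_factor :: "nat set \<Rightarrow> nat" where
  "k6_factor A = (if 6 \<in> A then 2 * \<Sum>(A - {6}) else \<Sum>A) mod 5"

text \<open>With 5 standing for the residue 0, this is cancellation modulo 5: a + b = a + c gives b
  = c, a + b = 2a gives b = a, and doubling is injective. The proof checks the finitely many
  cases.\<close>

lemma k6_factor_neq:
  assumes "a \<in> {1..6}" "b \<in> {1..6}" "c \<in> {1..6}" "a \<noteq> b" "a \<noteq> c" "b \<noteq> c"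
  shows "k6_factor {a, b} \<noteq> k6_factor {a, c}"
proof -
  have val: "k6_factor {u, v} = (if u = 6 then 2 * v else if v = 6 then 2 * u else u + v) mod 5"
    if "u \<noteq> v" for u v
    using that unfolding k6_factor_def by (auto simp: insert_Diff_if)
  have "{1..6::nat} = {1, 2, 3, 4, 5, 6}" by auto
  then show ?thesis
    using assms by (simp only: val[OF assms(4)] val[OF assms(5)]) (elim insertE emptyE; simp)
qed

text \<open>Five of the seven lines of the Fano plane on \<open>{1..7}\<close>. Distinct lines meet
  in one point, so they form a clique with one vertex for each colour of
  \<open>k6_factor\<close>.\<close>

definition fano_line :: "nat \<Rightarrow> nat set" where
  "fano_line i = [{1, 2, 3}, {1, 4, 5}, {1, 6, 7}, {2, 4, 6}, {2, 5, 7}] ! i"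

lemma fano_line:
  assumes "i < 5"
  shows "fano_line i \<subseteq> {1..8}" "card (fano_line i) = 3"
    and "j < 5 \<Longrightarrow> i \<noteq> j \<Longrightarrow> card (fano_line i \<inter> fano_line j) \<le> 1"
proof -
  have less5: "x < 5 \<longleftrightarrow> x = 0 \<or> x = 1 \<or> x = 2 \<or> x = 3 \<or> x = 4" for x :: nat
    by auto
  show "fano_line i \<subseteq> {1..8}" "card (fano_line i) = 3"
    using assms unfolding less5 fano_line_def by auto
  show "card (fano_line i \<inter> fano_line j) \<le> 1" if "j < 5" "i \<noteq> j"
    using assms that unfolding less5 fano_line_def by (elim disjE) auto
qed

text \<open>Here \<open>K(6, 2, 1)\<close> is complete on 15 vertices and Stahl's map points the
  wrong way, from \<open>K(8, 3, 1)\<close> to it. Instead, \<open>J(6, 2, 1)\<close> is the line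
  graph of the complete graph on 6 points, and its 5-colouring is mapped into the clique.\<close>

lemma johnson_6_2_chromatic_le:
  "chromatic_number (johnson_graph 6 2 1) \<le> chromatic_number (kneser_graph 8 3 1)"
proof (rule chromatic_number_hom_le[where f = "fano_line \<circ> k6_factor", OF pair_graph_kneser_graph])
  have less5: "k6_factor A < 5" for A
    unfolding k6_factor_def by simp
  show vert: "(fano_line \<circ> k6_factor) A \<in> pverts (kneser_graph 8 3 1)" for A
    using fano_line(1,2)[OF less5] by (simp add: kneser_graph_def Let_def)
  fix A B assume "(A, B) \<in> parcs (johnson_graph 6 2 1)"
  then have A: "A \<subseteq> {1..6}" "card A = 2" and B: "B \<subseteq> {1..6}" "card B = 2"
    and "card (A \<inter> B) = 1"
    by (auto simp: johnson_graph_def Let_def)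
  then obtain a where a: "A \<inter> B = {a}"
    by (auto simp: card_1_singleton_iff)
  obtain b where b: "A = {a, b}" "a \<noteq> b"
    using A(2) a by (metis Int_iff card_2_iff insert_commute insert_iff singletonD)
  obtain c where c: "B = {a, c}" "a \<noteq> c"
    using B(2) a by (metis Int_iff card_2_iff insert_commute insert_iff singletonD)
  have "k6_factor A \<noteq> k6_factor B"
    using k6_factor_neq[of a b c] A(1) B(1) a b c by auto
  then have le: "card (fano_line (k6_factor A) \<inter> fano_line (k6_factor B)) \<le> 1"
    by (intro fano_line(3) less5)
  moreover have "fano_line (k6_factor A) \<noteq> fano_line (k6_factor B)"
    using le fano_line(2)[OF less5, of A] by auto
  ultimately show "((fano_line \<circ> k6_factor) A, (fano_line \<circ> k6_factor) B) \<in> parcs (kneser_graph 8 3 1)"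
    using fano_line(1,2)[OF less5] by (simp add: kneser_graph_def Let_def)
qed

theorem theorem4p19:
  fixes n :: nat
  assumes "6 \<le> n" and "even n"
  shows "chromatic_number (exact_distance_cube n (n - 4))
           \<le> min (2 * chromatic_number (johnson_graph n ((n - 4) div 2) 0)
                     + chromatic_number (johnson_graph n (n div 2) 2))
                 (2 * chromatic_number (johnson_graph n ((n - 2) div 2) 1) + 2)
       \<and> min (2 * chromatic_number (johnson_graph n ((n - 4) div 2) 0)
                 + chromatic_number (johnson_graph n (n div 2) 2))
             (2 * chromatic_number (johnson_graph n ((n - 2) div 2) 1) + 2)
           \<le> 2 * chromatic_number (kneser_graph 8 3 1) + 2"
proof -
  obtain m where n: "n = 2 * m"
    using assms(2) by blast
  then have m: "3 \<le> m"
    using assms(1) by simp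
  have levels: "(n - 4) div 2 = m - 2" "n div 2 = m" "(n - 2) div 2 = m - 1"
    using n m by auto
  have "chromatic_number (johnson_graph (2 * m) (m - 1) 1) \<le> chromatic_number (kneser_graph 8 3 1)"
  proof (cases "m = 3")
    case True
    then show ?thesis
      using johnson_6_2_chromatic_le by simp
  next
    case False
    then have "4 \<le> m"
      using m by simp
    then show ?thesis
      using johnson_chromatic_le_kneser kneser_chromatic_le_8_3 le_trans by blast
  qed
  \<comment> \<open>The minimum is bounded through its second term.\<close>
  then show ?thesis
    using cube_chromatic_le_middle_level[OF m] cube_chromatic_le_near_middle_level[OF m]
    unfolding levels unfolding n by (auto intro: min.coboundedI2)
qed

end
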